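(* For every integer $k \geq 0$, let $n = 2^k-1$ and let $Ch_n(321;q) = \sum_{\sigma \in Av_n(321)} q^{ch(\sigma)}$. Then the coefficient of $q^i$ in $Ch_{2^k-1}(321;q)$ equals $1$ if $i=0$, and is an even number for every $i \geq 1$.
   Context: $S_n$ is the set of permutations of $[n]$ in one-line notation. A permutation $\pi$ avoids $321$ if it has no subsequence $\pi_a\pi_b\pi_c$ with $a<b<c$ and $\pi_a>\pi_b>\pi_c$; $Av_n(321)$ is the set of such permutations in $S_n$. For $\pi \in S_n$, the charge value $chv(i)$ of each $i\in[n]$ is defined by: $chv(1)=0$; for $i \geq 2$, $chv(i)=0$ if $i$ appears to the right of $i-1$ in $\pi$, and $chv(i)=n+1-i$ if $i$ appears to the left of $i-1$ in $\pi$. The charge of $\pi$ is $ch(\pi)=\sum_{i=1}^n chv(i)$. *)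

theory Defs
  imports "HOL-Computational_Algebra.Polynomial" "HOL-Combinatorics.Permutations"
begin

(* A permutation \<pi> of {1..n} has one-line notation \<pi> 1, ..., \<pi> n. *)
definition avoids_321 :: "nat \<Rightarrow> (nat \<Rightarrow> nat) \<Rightarrow> bool" where
  "avoids_321 n \<pi> \<longleftrightarrow>
     \<not> (\<exists>a\<in>{1..n}. \<exists>b\<in>{1..n}. \<exists>c\<in>{1..n}. a < b \<and> b < c \<and> \<pi> a > \<pi> b \<and> \<pi> b > \<pi> c)"

definition Av_321 :: "nat \<Rightarrow> (nat \<Rightarrow> nat) set" where
  "Av_321 n = {\<pi>. \<pi> permutes {1..n} \<and> avoids_321 n \<pi>}"

(* inv \<pi> i is the position of the value i in the one-line notation of \<pi>. The natural number
   subtraction n + 1 - i is exact for i in {1..n}. *)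
definition chv :: "nat \<Rightarrow> (nat \<Rightarrow> nat) \<Rightarrow> nat \<Rightarrow> nat" where
  "chv n \<pi> i = (if i \<ge> 2 \<and> inv \<pi> i < inv \<pi> (i - 1) then n + 1 - i else 0)"

definition charge :: "nat \<Rightarrow> (nat \<Rightarrow> nat) \<Rightarrow> nat" where
  "charge n \<pi> = (\<Sum>i=1..n. chv n \<pi> i)"

definition Ch_321 :: "nat \<Rightarrow> int poly" where
  "Ch_321 n = (\<Sum>\<sigma>\<in>Av_321 n. monom 1 (charge n \<sigma>))"

lemma finite_Av_321: "finite (Av_321 n)"
  using finite_permutations[of "{1..n}"] by (simp add: Av_321_def)

end

theory Submission
  imports Defs
begin

text \<open>The charge of \<open>\<sigma>\<close> only depends on the descent set of the inverse of \<open>\<sigma>\<close>, and inversion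
  preserves avoidance of 321. For every set \<open>E\<close>, the number of 321-avoiding words of length \<open>n\<close>
  whose descents lie in \<open>E\<close> is a sum of ballot numbers \<open>(n choose j) - (n choose (n + 1 - j))\<close>
  in which \<open>j = 0\<close> occurs exactly once. RSK explains this: for \<open>2 * j \<le> n\<close> the ballot number counts
  the standard tableaux of shape \<open>(n - j, j)\<close>, it changes sign under \<open>j \<mapsto> n + 1 - j\<close>, and after
  cancellation the multiplicities are Kostka numbers. When \<open>n = 2 ^ k - 1\<close>, all \<open>n choose j\<close> are
  odd, so the term for \<open>j = 0\<close> is 1 and all others are even: the count is odd for every \<open>E\<close>. By
  induction on \<open>D\<close>, the number of words with descent set exactly \<open>D\<close> is then even for every
  nonempty \<open>D\<close>, as the subsets of \<open>D\<close> contribute an odd total and the empty set an odd term.\<close>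

section \<open>321-avoiding words and their descents\<close>

text \<open>Only the earlier entry \<open>y\<close> is bounded, since a later \<open>z < y\<close>
  lies below \<open>m\<close> anyway. The pairs ruled out are those that would complete a 321 led by
  \<open>m\<close>.\<close>

definition increasing_below :: "'a::linorder \<Rightarrow> 'a list \<Rightarrow> bool" where
  "increasing_below m xs \<longleftrightarrow> sorted_wrt (\<lambda>y z. y < m \<longrightarrow> y \<le> z) xs"

lemma increasing_below_Nil [simp]: "increasing_below m []"
  by (simp add: increasing_below_def)

lemma increasing_below_Cons [simp]:
  "increasing_below m (x # xs) \<longleftrightarrow>
     (x < m \<longrightarrow> (\<forall>y\<in>set xs. x \<le> y)) \<and> increasing_below m xs"
  by (auto simp: increasing_below_def)

lemma increasing_below_antimono:
  "increasing_below n xs \<Longrightarrow> m \<le> n \<Longrightarrow> increasing_below m xs"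
  by (induction xs) auto

lemma increasing_below_lower_bound:
  "\<forall>y\<in>set xs. m \<le> y \<Longrightarrow> increasing_below m xs"
  by (induction xs) auto

fun avoids_321_list :: "'a::linorder list \<Rightarrow> bool" where
  "avoids_321_list [] = True"
| "avoids_321_list (x # xs) =
     (avoids_321_list xs \<and> increasing_below x xs)"

lemma avoids_321_list_iff_nth:
  "avoids_321_list xs \<longleftrightarrow>
     (\<forall>i j k. i < j \<longrightarrow> j < k \<longrightarrow> k < length xs \<longrightarrow> \<not> (xs ! k < xs ! j \<and> xs ! j < xs ! i))"
proof (induction xs)
  case (Cons x xs)
  have "(\<forall>i j k. i < j \<longrightarrow> j < k \<longrightarrow> k < length (x # xs) \<longrightarrow>
          \<not> ((x # xs) ! k < (x # xs) ! j \<and> (x # xs) ! j < (x # xs) ! i)) \<longleftrightarrow>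
        (\<forall>j k. j < k \<longrightarrow> k < length xs \<longrightarrow> \<not> (xs ! k < xs ! j \<and> xs ! j < x)) \<and>
        (\<forall>i j k. i < j \<longrightarrow> j < k \<longrightarrow> k < length xs \<longrightarrow> \<not> (xs ! k < xs ! j \<and> xs ! j < xs ! i))"
    (is "?L \<longleftrightarrow> ?R1 \<and> ?R2")
  proof (intro iffI conjI allI impI)
    fix j k assume ?L "j < k" "k < length xs"
    then show "\<not> (xs ! k < xs ! j \<and> xs ! j < x)"
      by (elim allE[of _ 0] allE[of _ "Suc j"] allE[of _ "Suc k"]) auto
  next
    fix i j k assume ?L "i < j" "j < k" "k < length xs"
    then show "\<not> (xs ! k < xs ! j \<and> xs ! j < xs ! i)"
      by (elim allE[of _ "Suc i"] allE[of _ "Suc j"] allE[of _ "Suc k"]) auto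
  next
    fix i j k assume R: "?R1 \<and> ?R2" and "i < j" "j < k" "k < length (x # xs)"
    then obtain j' k' where jk: "j = Suc j'" "k = Suc k'" "j' < k'" "k' < length xs"
      by (cases j; cases k) auto
    then show "\<not> ((x # xs) ! k < (x # xs) ! j \<and> (x # xs) ! j < (x # xs) ! i)"
      using R \<open>i < j\<close> by (cases i) auto
  qed
  also have "?R1 \<longleftrightarrow> increasing_below x xs"
    unfolding increasing_below_def sorted_wrt_iff_nth_less by (meson not_less)
  finally show ?case
    using Cons.IH by auto
qed simp

text \<open>A descent is recorded by the length of the suffix starting at its lower entry, because
  this is its contribution to the charge.\<close>

definition descents :: "'a::linorder list \<Rightarrow> nat set" where
  "descents xs = {r \<in> {1..<length xs}. xs ! (length xs - r) < xs ! (length xs - r - 1)}"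

lemma descents_Nil [simp]: "descents [] = {}"
  by (simp add: descents_def)

lemma descents_Cons:
  "descents (x # xs) = descents xs \<union> {r. r = length xs \<and> xs \<noteq> [] \<and> hd xs < x}"
proof (intro set_eqI)
  fix r
  consider "r = 0" | "length xs < r" | "r = length xs" "0 < r" | "0 < r" "r < length xs"
    by linarith
  then show "r \<in> descents (x # xs) \<longleftrightarrow>
      r \<in> descents xs \<union> {r. r = length xs \<and> xs \<noteq> [] \<and> hd xs < x}"
  proof cases
    case 3
    then show ?thesis
      by (cases xs) (auto simp: descents_def)
  next
    case 4
    then have "Suc (length xs) - r = Suc (length xs - r)"
      and "length xs - r = Suc (length xs - r - 1)"
      by auto
    then show ?thesis
      using 4 by (simp add: descents_def)
  qed (auto simp: descents_def)
qed

lemma sorted_if_descents_empty: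
  assumes "descents xs = {}"
  shows "sorted xs"
  using assms
proof (induction xs)
  case (Cons x xs)
  then have "sorted xs" "xs = [] \<or> x \<le> hd xs"
    by (auto simp: descents_Cons)
  then show ?case
    by (cases xs) auto
qed simp

section \<open>Building 321-avoiding words entry by entry\<close>

text \<open>When a permutation is read from left to right, \<open>m\<close> is the maximum so far and \<open>S\<close> the set of
  entries still to come: the entries below \<open>m\<close> have to appear in increasing order. If \<open>b\<close> is
  false, the step from the previous entry to the next one must not be a descent.\<close>

definition completions :: "(nat \<Rightarrow> bool) \<Rightarrow> bool \<Rightarrow> 'a::linorder \<Rightarrow> 'a set \<Rightarrow> 'a list set" where
  "completions P b m S = {xs. distinct xs \<and> set xs = S \<and> avoids_321_list xs \<and>
     increasing_below m xs \<and> descents xs \<subseteq> Collect P \<and>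
     (b \<or> xs = [] \<or> m \<le> hd xs)}"

lemma finite_completions: "finite S \<Longrightarrow> finite (completions P b m S)"
  by (rule finite_subset[OF _ finite_subset_distinct[of S]]) (auto simp: completions_def)

lemma completions_empty: "completions P b m {} = {[]}"
  by (auto simp: completions_def)

text \<open>Here \<open>x\<close> is the new maximum, and its condition on \<open>xs\<close> implies
  the one for \<open>m\<close>. A descent right after \<open>x\<close> would be recorded as
  \<open>card S - 1\<close>, the number of entries after \<open>x\<close>; this gives the new
  flag.\<close>

lemma Cons_in_completions_ge:
  assumes "m \<le> x"
  shows "x # xs \<in> completions P b m S \<longleftrightarrow>
           x \<in> S \<and> xs \<in> completions P (P (card S - 1)) x (S - {x})"
proof -
  have mono: "increasing_below m xs" if "increasing_below x xs"
    using increasing_below_antimono[OF that assms] .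
  show ?thesis
  proof (cases "x \<in> S \<and> distinct xs \<and> set xs = S - {x}")
    case True
    then have "card S - 1 = length xs" "insert x S = S"
      using distinct_card[of xs] by (auto simp: insert_absorb)
    then show ?thesis
      using True assms mono
      by (simp add: completions_def descents_Cons) (auto simp: not_le)
  next
    case False
    then show ?thesis
      by (auto simp: completions_def)
  qed
qed

text \<open>An entry below \<open>m\<close> must not exceed any later one, which forces
  \<open>Min S\<close>. The step after it is an ascent, so the new flag is
  \<open>True\<close>.\<close>

lemma Cons_in_completions_less:
  assumes "x < m" "finite S"
  shows "x # xs \<in> completions P b m S \<longleftrightarrow>
           b \<and> S \<noteq> {} \<and> x = Min S \<and> xs \<in> completions P True m (S - {x})"
proof
  assume x: "x # xs \<in> completions P b m S"
  then have "x \<in> S" "\<forall>y\<in>S. x \<le> y"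
    using assms by (auto simp: completions_def)
  then have "x = Min S"
    using assms by (metis Min_eqI)
  then show "b \<and> S \<noteq> {} \<and> x = Min S \<and> xs \<in> completions P True m (S - {x})"
    using x assms by (auto simp: completions_def descents_Cons not_le)
next
  assume r: "b \<and> S \<noteq> {} \<and> x = Min S \<and> xs \<in> completions P True m (S - {x})"
  then have x: "x \<in> S" "\<forall>y\<in>S. x \<le> y"
    using assms by auto
  have r': "b" "xs \<in> completions P True m (S - {x})"
    using r by auto
  then have xs: "set xs = S - {x}"
    by (simp add: completions_def)
  have "increasing_below x xs"
    using x xs by (intro increasing_below_lower_bound) auto
  moreover have "xs = [] \<or> \<not> hd xs < x"
    using x xs hd_in_set[of xs] by fastforce
  ultimately show "x # xs \<in> completions P b m S"
    using r' x xs assms by (auto simp: completions_def descents_Cons)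
qed

text \<open>The second number counts the entries to come, and \<open>s\<close> those of them that
  are at least the current maximum. The first summand places the smallest entry below the maximum,
  the second a new maximum that \<open>s'\<close> later entries exceed.\<close>

fun num_completions :: "(nat \<Rightarrow> bool) \<Rightarrow> bool \<Rightarrow> nat \<Rightarrow> nat \<Rightarrow> nat" where
  "num_completions P b 0 s = 1"
| "num_completions P b (Suc r) s =
     (if b \<and> s \<le> r then num_completions P True r s else 0) +
     (\<Sum>s'<s. num_completions P (P r) r s')"

lemma sum_card_greater:
  fixes T :: "'a::linorder set" and h :: "nat \<Rightarrow> 'b::comm_monoid_add"
  assumes "finite T"
  shows "(\<Sum>x\<in>T. h (card {y \<in> T. x < y})) = (\<Sum>i<card T. h i)"
  using assms
proof (induction rule: finite_linorder_min_induct)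
  case (insert b A)
  have "{y \<in> insert b A. b < y} = A" "b \<notin> A"
    using insert by auto
  moreover have "{y \<in> insert b A. x < y} = {y \<in> A. x < y}" if "x \<in> A" for x
    using insert that by auto
  ultimately show ?case
    using insert by (simp add: add.commute)
qed simp

lemma card_completions:
  fixes S :: "'a::linorder set"
  assumes "finite S" "card S = r"
  shows "card (completions P b m S) = num_completions P b r (card {y \<in> S. m \<le> y})"
  using assms
proof (induction r arbitrary: S b m)
  case 0
  then show ?case
    by (simp add: completions_empty)
next
  case (Suc r)
  let ?T = "{y \<in> S. m \<le> y}"
  let ?s = "card ?T"
  define A where "A = (if b \<and> Min S < m
    then (#) (Min S) ` completions P True m (S - {Min S}) else {})"
  define B where "B = (\<lambda>x. (#) x ` completions P (P r) x (S - {x}))"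
  have S: "S \<noteq> {}" "Min S \<in> S"
    using Suc.prems by (auto intro: Min_in)
  have "completions P b m S = A \<union> (\<Union>x\<in>?T. B x)"
  proof (intro set_eqI)
    fix xs
    show "xs \<in> completions P b m S \<longleftrightarrow> xs \<in> A \<union> (\<Union>x\<in>?T. B x)"
    proof (cases xs)
      case Nil
      then show ?thesis
        using S by (auto simp: A_def B_def completions_def)
    next
      case (Cons x ys)
      then show ?thesis
        using Cons_in_completions_ge[of m x ys P b S] Cons_in_completions_less[of x m S ys P b]
          Suc.prems S
        by (cases "m \<le> x") (auto simp: A_def B_def)
    qed
  qed
  moreover have "A \<inter> (\<Union>x\<in>?T. B x) = {}"
    by (auto simp: A_def B_def)
  moreover have "finite A" "\<And>x. finite (B x)"
    using Suc.prems by (auto simp: A_def B_def intro!: finite_completions)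
  moreover have "B x \<inter> B y = {}" if "x \<noteq> y" for x y
    using that by (auto simp: B_def)
  ultimately have "card (completions P b m S) = card A + (\<Sum>x\<in>?T. card (B x))"
    using Suc.prems by (simp add: card_Un_disjoint card_UN_disjoint)
  moreover have "card A = (if b \<and> ?s \<le> r then num_completions P True r ?s else 0)"
  proof -
    \<comment> \<open>An entry below \<open>m\<close> is available exactly if not all
      \<open>Suc r\<close> entries are counted by \<open>?s\<close>; this is the test
      \<open>s \<le> r\<close> of the recursion.\<close>
    have "Min S < m \<longleftrightarrow> ?T \<noteq> S"
    proof -
      have "Min S < m \<longleftrightarrow> (\<exists>y\<in>S. y < m)"
        using S Suc.prems by (simp add: Min_less_iff)
      then show ?thesis
        by (simp add: set_eq_iff) (meson not_le)
    qed
    also have "\<dots> \<longleftrightarrow> ?s \<noteq> card S"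
      using Suc.prems card_subset_eq[of S ?T] by auto
    also have "\<dots> \<longleftrightarrow> ?s \<le> r"
      using Suc.prems card_mono[of S ?T] by auto
    finally have less: "Min S < m \<longleftrightarrow> ?s \<le> r" .
    have "{y \<in> S - {Min S}. m \<le> y} = ?T" if "Min S < m"
      using that by auto
    then show ?thesis
      using less Suc S by (auto simp: A_def card_image)
  qed
  moreover have "(\<Sum>x\<in>?T. card (B x)) = (\<Sum>x\<in>?T. num_completions P (P r) r (card {y \<in> ?T. x < y}))"
  proof (rule sum.cong)
    fix x assume "x \<in> ?T"
    moreover from this have "{y \<in> S - {x}. x \<le> y} = {y \<in> ?T. x < y}"
      by auto
    ultimately show "card (B x) = num_completions P (P r) r (card {y \<in> ?T. x < y})"
      using Suc by (simp add: B_def card_image)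
  qed simp
  ultimately show ?case
    using Suc.prems sum_card_greater[of ?T "num_completions P (P r) r"] by simp
qed

section \<open>Sums of ballot numbers\<close>

text \<open>The ballot number proper is the case \<open>s = r\<close>; other \<open>s\<close> are
  needed because the recursion sums over \<open>s\<close>.\<close>

definition ballot :: "nat \<Rightarrow> nat \<Rightarrow> nat \<Rightarrow> int" where
  "ballot r j s = int (s choose j) - int (s choose (Suc r - j))"

lemma sum_list_map_concat:
  "(\<Sum>x\<leftarrow>concat xss. f x) = (\<Sum>xs\<leftarrow>xss. \<Sum>x\<leftarrow>xs. f x)"
  for f :: "'a \<Rightarrow> 'b::monoid_add"
  by (induction xss) (auto simp: add.assoc)

lemma sum_lessThan_choose: "(\<Sum>i<s. i choose j) = s choose Suc j"
  by (induction s) auto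

text \<open>By symmetry of binomial coefficients, the subtracted part of each term is the first part
  of its predecessor, so the sum telescopes. The form \<open>Suc r - j\<close> of the lower end also
  covers \<open>j = 0\<close>, where it contributes 0.\<close>

lemma sum_ballot_diagonal:
  "j + v \<le> r \<Longrightarrow>
     (\<Sum>i\<le>v. ballot r (j + i) r) = int (r choose (j + v)) - int (r choose (Suc r - j))"
proof (induction v)
  case (Suc v)
  then have "r choose (r - (j + v)) = r choose (j + v)"
    using binomial_symmetric[of "j + v" r] by simp
  with Suc show ?case
    by (simp add: ballot_def)
qed (simp add: ballot_def)

text \<open>This matches the recursion when a block grows by one entry. For
  \<open>s \<le> r\<close>, the sums on both sides differ by one binomial at an end of each; for
  \<open>s = Suc r\<close>, the whole left side telescopes.\<close>

lemma sum_ballot_Suc: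
  assumes "j \<le> b" "b + u = r" "s \<le> Suc r"
  shows "(\<Sum>i\<le>Suc u. ballot (Suc r) (j + i) s) =
           (if s \<le> r then \<Sum>i\<le>u. ballot r (j + i) s else 0) +
           (int (s choose (j + Suc u)) - int (s choose (Suc b - j + Suc u)))"
proof (cases "s \<le> r")
  case True
  have "(\<Sum>i\<le>Suc u. int (s choose (Suc (Suc r) - (j + i)))) =
          int (s choose (Suc b - j + Suc u)) + (\<Sum>i\<le>u. int (s choose (Suc r - (j + i))))"
    using assms by (simp add: sum.atMost_Suc_shift Suc_diff_le del: sum.atMost_Suc)
  then show ?thesis
    using True by (simp add: ballot_def sum_subtractf)
next
  case False
  then have "s = Suc r"
    using assms by simp
  moreover have "Suc (Suc r) - j = Suc b - j + Suc u"
    using assms by simp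
  ultimately show ?thesis
    using sum_ballot_diagonal[of j "Suc u" "Suc r"] assms by simp
qed

text \<open>Reading a block backwards, \<open>b\<close> is the number of entries after the block and \<open>u\<close> the
  number of entries of the block read so far. The second equation is Pieri's rule for shapes
  with two rows.\<close>

lemma num_completions_eq_sum_ballot:
  "\<exists>b u ts. b + u = r \<and> set ts \<subseteq> {1..b} \<and>
     (\<forall>s\<le>r. int (num_completions P (P r) r s) =
        (\<Sum>j\<leftarrow>0 # ts. int (s choose (j + u)) - int (s choose (Suc b - j + u)))) \<and>
     (\<forall>s\<le>r. int (num_completions P True r s) = (\<Sum>j\<leftarrow>0 # ts. \<Sum>i\<le>u. ballot r (j + i) s))"
proof (induction r)
  case 0
  show ?case
    by (intro exI[of _ 0] exI[of _ "[]"]) (simp add: ballot_def)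
next
  case (Suc r)
  then obtain b u ts where b: "b + u = r" and ts: "set ts \<subseteq> {1..b}"
    and E: "\<And>s. s \<le> r \<Longrightarrow> int (num_completions P (P r) r s) =
        (\<Sum>j\<leftarrow>0 # ts. int (s choose (j + u)) - int (s choose (Suc b - j + u)))"
    and F: "\<And>s. s \<le> r \<Longrightarrow>
        int (num_completions P True r s) = (\<Sum>j\<leftarrow>0 # ts. \<Sum>i\<le>u. ballot r (j + i) s)"
    by blast
  define js where "js = 0 # ts"
  have js: "\<And>j. j \<in> set js \<Longrightarrow> j \<le> b"
    using ts by (auto simp: js_def)
  \<comment> \<open>Without the first summand, the recursion is a sum over \<open>i < s\<close>,
    which raises every lower index by one: \<open>u\<close> becomes \<open>Suc u\<close>.\<close>
  have False_eq: "int (num_completions P False (Suc r) s) =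
      (\<Sum>j\<leftarrow>js. int (s choose (j + Suc u)) - int (s choose (Suc b - j + Suc u)))"
    if "s \<le> Suc r" for s
  proof -
    have "int (num_completions P False (Suc r) s) =
        (\<Sum>i<s. \<Sum>j\<leftarrow>js. int (i choose (j + u)) - int (i choose (Suc b - j + u)))"
      using that by (simp add: E js_def del: sum_list.Cons list.map)
    also have "\<dots> = (\<Sum>j\<leftarrow>js. \<Sum>i<s. int (i choose (j + u)) - int (i choose (Suc b - j + u)))"
      by (induction js) (auto simp: sum.distrib)
    also have "\<dots> = (\<Sum>j\<leftarrow>js. int (s choose (j + Suc u)) - int (s choose (Suc b - j + Suc u)))"
      by (simp add: sum_subtractf flip: of_nat_sum sum_lessThan_choose)
    finally show ?thesis .
  qed
  have True_eq: "int (num_completions P True (Suc r) s) =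
      (\<Sum>j\<leftarrow>js. \<Sum>i\<le>Suc u. ballot (Suc r) (j + i) s)"
    if s: "s \<le> Suc r" for s
  proof -
    have "int (num_completions P True (Suc r) s) =
        (if s \<le> r then \<Sum>j\<leftarrow>js. \<Sum>i\<le>u. ballot r (j + i) s else 0) +
        int (num_completions P False (Suc r) s)"
      by (simp add: F js_def del: sum_list.Cons list.map)
    also have "\<dots> = (\<Sum>j\<leftarrow>js. (if s \<le> r then \<Sum>i\<le>u. ballot r (j + i) s else 0) +
        (int (s choose (j + Suc u)) - int (s choose (Suc b - j + Suc u))))"
      unfolding False_eq[OF s] sum_list_addf by simp
    also have "\<dots> = (\<Sum>j\<leftarrow>js. \<Sum>i\<le>Suc u. ballot (Suc r) (j + i) s)"
      using s b js by (intro arg_cong[of _ _ sum_list] map_cong refl sum_ballot_Suc[symmetric])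
    finally show ?thesis .
  qed
  show ?case
  proof (cases "P (Suc r)")
    case False
    then show ?thesis
      using False_eq True_eq ts b js_def
      by (intro exI[of _ b] exI[of _ "Suc u"] exI[of _ ts]) auto
  next
    case True
    \<comment> \<open>The block of \<open>Suc u\<close> entries is complete, and each
      \<open>j\<close> branches into \<open>j, ..., j + Suc u\<close>. The branches of
      \<open>j = 0\<close> start at 1 here, as the single 0 is kept apart.\<close>
    define ts' where "ts' = [1..<Suc (Suc u)] @ concat (map (\<lambda>j. [j..<j + Suc (Suc u)]) ts)"
    have "0 # ts' = concat (map (\<lambda>j. [j..<j + Suc (Suc u)]) js)"
      by (simp add: ts'_def js_def upt_rec[of 0])
    then have "(\<Sum>j\<leftarrow>0 # ts'. ballot (Suc r) j s) =
        (\<Sum>j\<leftarrow>js. \<Sum>i\<leftarrow>[j..<j + Suc (Suc u)]. ballot (Suc r) i s)" for s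
      by (simp only: sum_list_map_concat map_map o_def)
    moreover have "(\<Sum>i\<leftarrow>[j..<j + Suc (Suc u)]. ballot (Suc r) i s) =
        (\<Sum>i\<le>Suc u. ballot (Suc r) (j + i) s)" for j s
      using sum.shift_bounds_nat_ivl[of "\<lambda>j. ballot (Suc r) j s" 0 j "Suc (Suc u)"]
      by (simp add: interv_sum_list_conv_sum_set_nat atLeast0LessThan lessThan_Suc_atMost
          add.commute del: upt_Suc sum.lessThan_Suc sum.atMost_Suc)
    ultimately have "(\<Sum>j\<leftarrow>0 # ts'. ballot (Suc r) j s) =
        (\<Sum>j\<leftarrow>js. \<Sum>i\<le>Suc u. ballot (Suc r) (j + i) s)" for s
      by (simp only:)
    then have "int (num_completions P True (Suc r) s) = (\<Sum>j\<leftarrow>0 # ts'. ballot (Suc r) j s)"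
      if "s \<le> Suc r" for s
      using True_eq that by simp
    moreover have "set ts' \<subseteq> {1..Suc r}"
      using ts b by (fastforce simp: ts'_def)
    ultimately show ?thesis
      using True
      by (intro exI[of _ "Suc r"] exI[of _ 0] exI[of _ ts']) (simp add: ballot_def)
  qed
qed

section \<open>Parity of the counts\<close>

lemma odd_num_completions:
  assumes odd: "\<And>j. j \<le> r \<Longrightarrow> odd (r choose j)"
  shows "odd (num_completions P True r r)"
proof -
  obtain b u ts where b: "b + u = r" and ts: "set ts \<subseteq> {1..b}"
    and eq: "\<forall>s\<le>r. int (num_completions P True r s) =
      (\<Sum>j\<leftarrow>0 # ts. \<Sum>i\<le>u. ballot r (j + i) s)"
    using num_completions_eq_sum_ballot by blast
  have sum: "(\<Sum>i\<le>u. ballot r (j + i) r) = int (r choose (j + u)) - int (r choose (Suc r - j))"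
    if "j \<le> b" for j
    using that b by (intro sum_ballot_diagonal) simp
  \<comment> \<open>For \<open>j = 0\<close> the sum is \<open>r choose u\<close>, because
    \<open>r choose Suc r\<close> is 0. For \<open>j \<ge> 1\<close> it is a difference of two odd
    binomials.\<close>
  have "odd (\<Sum>i\<le>u. ballot r (0 + i) r)"
    using sum[of 0] odd[of u] b by (simp add: binomial_eq_0)
  moreover have even: "even (\<Sum>i\<le>u. ballot r (j + i) r)" if "j \<in> {1..b}" for j
    using sum[of j] odd[of "j + u"] odd[of "Suc r - j"] b that by force
  have "even (\<Sum>j\<leftarrow>ts. \<Sum>i\<le>u. ballot r (j + i) r)"
    using ts by (induction ts) (auto simp: even)
  ultimately show ?thesis
    using eq[rule_format, of r] by (simp flip: even_of_nat[where ?'a = int])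
qed

text \<open>By Pascal's rule, neighbouring binomials of row \<open>n\<close> have equal parity,
  since the inner entries of row \<open>2 ^ k\<close> are even: an odd one would make
  \<open>2 ^ k\<close> divide \<open>Suc j\<close>, which is too small.\<close>

lemma odd_choose_if_Suc_eq_two_power:
  assumes n: "Suc n = 2 ^ k" and "j \<le> n"
  shows "odd (n choose j)"
  using assms(2)
proof (induction j)
  case (Suc j)
  have "even (Suc n choose Suc j)"
  proof (rule ccontr)
    assume "odd (Suc n choose Suc j)"
    then have "coprime (2 ^ k) (Suc n choose Suc j)"
      by simp
    moreover have "2 ^ k dvd Suc j * (Suc n choose Suc j)"
      using Suc_times_binomial[of j n] n by (metis dvd_triv_left)
    ultimately have "2 ^ k dvd Suc j"
      using coprime_dvd_mult_left_iff by blast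
    then show False
      using Suc.prems dvd_imp_le[of "2 ^ k" "Suc j"] by (simp flip: n)
  qed
  then show ?case
    using Suc by simp
qed simp

text \<open>Moebius inversion over finite sets modulo 2: the constant 1 inverts to the indicator of
  the empty set.\<close>

lemma even_card_if_odd_card_subset:
  fixes f :: "'a \<Rightarrow> 'b set"
  assumes "finite W" "finite D" "D \<noteq> {}"
    and odd: "\<And>E. finite E \<Longrightarrow> odd (card {x \<in> W. f x \<subseteq> E})"
  shows "even (card {x \<in> W. f x = D})"
  using assms(2,3)
proof (induction D rule: finite_psubset_induct)
  case (psubset D)
  let ?N = "\<lambda>E. card {x \<in> W. f x = E}"
  have "{x \<in> W. f x \<subseteq> D} = (\<Union>E\<in>Pow D. {x \<in> W. f x = E})"
    by auto
  also have "card \<dots> = (\<Sum>E\<in>Pow D. ?N E)"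
    using assms(1) psubset by (intro card_UN_disjoint) auto
  also have "Pow D = insert D (insert {} (Pow D - {D, {}}))"
    by auto
  also have "(\<Sum>E\<in>\<dots>. ?N E) = ?N D + (?N {} + (\<Sum>E\<in>Pow D - {D, {}}. ?N E))"
    using psubset by simp
  finally have "odd (?N D + (?N {} + (\<Sum>E\<in>Pow D - {D, {}}. ?N E)))"
    using odd[of D] psubset by simp
  moreover have "even (\<Sum>E\<in>Pow D - {D, {}}. ?N E)"
    using psubset by (intro dvd_sum psubset.IH) auto
  moreover have "odd (?N {})"
    using odd[of "{}"] by simp
  ultimately show ?case
    by simp
qed

section \<open>Inverse permutations and charge\<close>

definition inverse_word :: "nat \<Rightarrow> (nat \<Rightarrow> nat) \<Rightarrow> nat list" where
  "inverse_word n \<pi> = map (inv \<pi>) [1..<Suc n]"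

lemma length_inverse_word [simp]: "length (inverse_word n \<pi>) = n"
  by (simp add: inverse_word_def)

lemma nth_inverse_word: "i < n \<Longrightarrow> inverse_word n \<pi> ! i = inv \<pi> (Suc i)"
  by (simp add: inverse_word_def del: upt_Suc)

lemma bij_betw_inverse_word:
  "bij_betw (inverse_word n) {\<pi>. \<pi> permutes {1..n}} {xs. distinct xs \<and> set xs = {1..n}}"
proof (rule bij_betwI')
  fix \<pi> \<sigma> assume "\<pi> \<in> {\<pi>. \<pi> permutes {1..n}}" "\<sigma> \<in> {\<pi>. \<pi> permutes {1..n}}"
  then have p: "\<pi> permutes {1..n}" "\<sigma> permutes {1..n}"
    by auto
  show "inverse_word n \<pi> = inverse_word n \<sigma> \<longleftrightarrow> \<pi> = \<sigma>"
  proof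
    assume "inverse_word n \<pi> = inverse_word n \<sigma>"
    then have "inv \<pi> i = inv \<sigma> i" if "i \<in> {1..n}" for i
      using that by (auto simp: inverse_word_def simp del: upt_Suc)
    moreover have "inv \<pi> i = inv \<sigma> i" if "i \<notin> {1..n}" for i
      using that p[THEN permutes_inv] by (simp add: permutes_not_in)
    ultimately have "inv \<pi> = inv \<sigma>"
      by blast
    then show "\<pi> = \<sigma>"
      using p[THEN permutes_bij] by (metis inv_inv_eq)
  qed simp
next
  fix \<pi> assume "\<pi> \<in> {\<pi>. \<pi> permutes {1..n}}"
  then have "inv \<pi> permutes {1..n}"
    by (simp add: permutes_inv)
  then show "inverse_word n \<pi> \<in> {xs. distinct xs \<and> set xs = {1..n}}"
    using permutes_image[of "inv \<pi>" "{1..n}"]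
    by (auto simp: inverse_word_def distinct_map permutes_inj_on atLeastLessThanSuc_atLeastAtMost
        simp del: upt_Suc)
next
  fix xs assume "xs \<in> {xs. distinct xs \<and> set xs = {1..n}}"
  then have xs: "distinct xs" "set xs = {1..n}" "length xs = n"
    using distinct_card[of xs] by auto
  \<comment> \<open>List indices start at 0 and positions at 1; outside \<open>{1..n}\<close>,
    \<open>permutes\<close> demands the identity.\<close>
  define \<rho> where "\<rho> = (\<lambda>i. if i \<in> {1..n} then xs ! (i - 1) else i)"
  have "bij_betw (\<lambda>i. i - 1) {1..n} {..<n}"
    by (rule bij_betw_byWitness[of _ Suc]) auto
  then have "bij_betw ((!) xs \<circ> (\<lambda>i. i - 1)) {1..n} {1..n}"
    by (rule bij_betw_trans) (use bij_betw_nth[of xs "{..<n}" "{1..n}"] xs in simp)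
  then have "bij_betw \<rho> {1..n} {1..n}"
    by (rule bij_betw_cong[THEN iffD1, rotated]) (simp add: \<rho>_def)
  then have \<rho>: "\<rho> permutes {1..n}"
    by (rule bij_imp_permutes) (auto simp: \<rho>_def)
  then have "inverse_word n (inv \<rho>) = xs"
    using xs by (intro nth_equalityI)
      (simp_all add: nth_inverse_word inv_inv_eq permutes_bij, simp add: \<rho>_def)
  then show "\<exists>\<pi>\<in>{\<pi>. \<pi> permutes {1..n}}. xs = inverse_word n \<pi>"
    using permutes_inv[OF \<rho>] by blast
qed

text \<open>The pattern 321 is its own inverse: positions \<open>a < b < c\<close> with decreasing
  values become entries \<open>c, b, a\<close> at increasing places of the inverse word.\<close>

lemma avoids_321_list_inverse_word:
  assumes "\<pi> permutes {1..n}"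
  shows "avoids_321_list (inverse_word n \<pi>) \<longleftrightarrow> avoids_321 n \<pi>"
proof -
  note inv = permutes_inverses[OF assms]
  have mem: "\<pi> i \<in> {1..n} \<longleftrightarrow> i \<in> {1..n}" "inv \<pi> i \<in> {1..n} \<longleftrightarrow> i \<in> {1..n}" for i
    using permutes_in_image[OF assms] permutes_in_image[OF permutes_inv[OF assms]] by simp_all
  show ?thesis
  proof
    assume L: "avoids_321_list (inverse_word n \<pi>)"
    show "avoids_321 n \<pi>"
      unfolding avoids_321_def
    proof (intro notI, elim bexE conjE)
      fix a b c assume abc: "a \<in> {1..n}" "b \<in> {1..n}" "c \<in> {1..n}"
        "a < b" "b < c" "\<pi> a > \<pi> b" "\<pi> b > \<pi> c"
      then have "\<pi> a \<in> {1..n}" "\<pi> b \<in> {1..n}" "\<pi> c \<in> {1..n}"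
        by (simp_all only: mem)
      moreover from this have "inverse_word n \<pi> ! (\<pi> i - 1) = i" if "i \<in> {a, b, c}" for i
        using that by (auto simp: nth_inverse_word inv)
      ultimately show False
        using L[unfolded avoids_321_list_iff_nth, rule_format, of "\<pi> c - 1" "\<pi> b - 1" "\<pi> a - 1"] abc
        by simp linarith
    qed
  next
    assume R: "avoids_321 n \<pi>"
    show "avoids_321_list (inverse_word n \<pi>)"
      unfolding avoids_321_list_iff_nth
    proof (intro allI impI notI)
      fix i j k assume ijk: "i < j" "j < k" "k < length (inverse_word n \<pi>)"
        "inverse_word n \<pi> ! k < inverse_word n \<pi> ! j \<and> inverse_word n \<pi> ! j < inverse_word n \<pi> ! i"
      then have "i < n" "j < n" "k < n"
        by simp_all
      moreover from this have "Suc i \<in> {1..n}" "Suc j \<in> {1..n}" "Suc k \<in> {1..n}"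
        by simp_all
      then have "inv \<pi> (Suc i) \<in> {1..n}" "inv \<pi> (Suc j) \<in> {1..n}" "inv \<pi> (Suc k) \<in> {1..n}"
        by (simp_all only: mem)
      ultimately show False
        using R[unfolded avoids_321_def, simplified, rule_format,
            of "inv \<pi> (Suc k)" "inv \<pi> (Suc j)" "inv \<pi> (Suc i)"] ijk
        by (simp add: nth_inverse_word inv)
    qed
  qed
qed

text \<open>If \<open>i\<close> stands left of \<open>i - 1\<close>, the inverse word descends to
  its entry for \<open>i\<close>, where a suffix of length \<open>n + 1 - i\<close> starts.\<close>

lemma charge_eq_sum_descents: "charge n \<pi> = \<Sum>(descents (inverse_word n \<pi>))"
proof -
  define I where "I = {i \<in> {1..n}. i \<ge> 2 \<and> inv \<pi> i < inv \<pi> (i - 1)}"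
  have "charge n \<pi> = (\<Sum>i\<in>I. n + 1 - i)"
    unfolding charge_def chv_def I_def by (rule sum.inter_filter[symmetric]) simp
  also have "\<dots> = \<Sum>(descents (inverse_word n \<pi>))"
  proof (rule sum.reindex_bij_witness[of _ "\<lambda>r. n + 1 - r" "\<lambda>i. n + 1 - i"])
    fix i assume i: "i \<in> I"
    then show "n + 1 - i \<in> descents (inverse_word n \<pi>)"
      by (auto simp: I_def descents_def nth_inverse_word Suc_diff_Suc numeral_2_eq_2)
  next
    fix r assume r: "r \<in> descents (inverse_word n \<pi>)"
    then show "n + 1 - r \<in> I"
      by (auto simp: I_def descents_def nth_inverse_word Suc_diff_Suc Suc_diff_le)
  qed (auto simp: I_def descents_def)
  finally show ?thesis .
qed

theorem theorem4:
  fixes k :: nat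
  shows "coeff (Ch_321 (2 ^ k - 1)) 0 = 1 \<and>
         (\<forall>i\<ge>1. even (coeff (Ch_321 (2 ^ k - 1)) i))"
proof -
  define n :: nat where "n = 2 ^ k - 1"
  define W where "W = {xs. distinct xs \<and> set xs = {1..n} \<and> avoids_321_list xs}"
  have finite_W: "finite W"
    by (rule finite_subset[OF _ finite_subset_distinct[of "{1..n}"]]) (auto simp: W_def)
  have odd: "odd (card {xs \<in> W. descents xs \<subseteq> E})" for E
  proof -
    \<comment> \<open>With \<open>m = 0\<close> and flag \<open>True\<close>, the conditions on the
      previous maximum are void.\<close>
    have "{xs \<in> W. descents xs \<subseteq> E} = completions (\<lambda>r. r \<in> E) True 0 {1..n}"
      by (auto simp: W_def completions_def increasing_below_lower_bound)
    moreover have "{y \<in> {1..n}. 0 \<le> y} = {1..n}"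
      by auto
    ultimately have "card {xs \<in> W. descents xs \<subseteq> E} = num_completions (\<lambda>r. r \<in> E) True n n"
      using card_completions[of "{1..n}" n "\<lambda>r. r \<in> E" True 0] by simp
    then show ?thesis
      using odd_num_completions odd_choose_if_Suc_eq_two_power[of n k] by (simp add: n_def)
  qed
  have coeff: "coeff (Ch_321 n) i = int (card {xs \<in> W. \<Sum>(descents xs) = i})" for i
  proof -
    have "bij_betw (inverse_word n) {\<sigma> \<in> Av_321 n. charge n \<sigma> = i} {xs \<in> W. \<Sum>(descents xs) = i}"
    proof (rule bij_betw_subset[OF bij_betw_inverse_word])
      show "inverse_word n ` {\<sigma> \<in> Av_321 n. charge n \<sigma> = i} = {xs \<in> W. \<Sum>(descents xs) = i}"
      proof (intro equalityI subsetI)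
        fix xs assume "xs \<in> {xs \<in> W. \<Sum>(descents xs) = i}"
        moreover from this have "xs \<in> inverse_word n ` {\<pi>. \<pi> permutes {1..n}}"
          by (simp only: W_def bij_betw_imp_surj_on[OF bij_betw_inverse_word]) simp
        then obtain \<pi> where "\<pi> permutes {1..n}" "xs = inverse_word n \<pi>"
          by blast
        ultimately show "xs \<in> inverse_word n ` {\<sigma> \<in> Av_321 n. charge n \<sigma> = i}"
          by (auto simp: W_def Av_321_def avoids_321_list_inverse_word charge_eq_sum_descents)
      next
        fix xs assume "xs \<in> inverse_word n ` {\<sigma> \<in> Av_321 n. charge n \<sigma> = i}"
        then obtain \<pi> where "\<pi> permutes {1..n}" "avoids_321 n \<pi>" "charge n \<pi> = i"
          "xs = inverse_word n \<pi>"
          by (auto simp: Av_321_def)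
        then show "xs \<in> {xs \<in> W. \<Sum>(descents xs) = i}"
          using bij_betwE[OF bij_betw_inverse_word[of n]]
          by (simp add: W_def avoids_321_list_inverse_word charge_eq_sum_descents)
      qed
    qed (auto simp: Av_321_def)
    then have "card {\<sigma> \<in> Av_321 n. charge n \<sigma> = i} = card {xs \<in> W. \<Sum>(descents xs) = i}"
      by (rule bij_betw_same_card)
    moreover have "coeff (Ch_321 n) i = int (card {\<sigma> \<in> Av_321 n. charge n \<sigma> = i})"
      using finite_Av_321[of n] by (simp add: Ch_321_def coeff_sum sum.If_cases Int_def)
    ultimately show ?thesis
      by simp
  qed
  have "coeff (Ch_321 n) 0 = 1"
  proof -
    have "{xs \<in> W. \<Sum>(descents xs) = 0} = {xs \<in> W. descents xs \<subseteq> {}}"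
      by (auto simp: descents_def)
    moreover have "xs = sorted_list_of_set {1..n}" if "xs \<in> W" "descents xs \<subseteq> {}" for xs
      using that sorted_if_descents_empty[of xs] sorted_list_of_set.idem_if_sorted_distinct[of xs]
      by (auto simp: W_def)
    then have "{xs \<in> W. descents xs \<subseteq> {}} \<subseteq> {sorted_list_of_set {1..n}}"
      by blast
    \<comment> \<open>There is at most one word without descents, and oddness for
      \<open>E = {}\<close> shows that it exists.\<close>
    ultimately show ?thesis
      using odd[of "{}"] by (auto simp: coeff dest!: subset_singletonD)
  qed
  moreover have "even (coeff (Ch_321 n) i)" if "i \<ge> 1" for i
  proof -
    let ?\<D> = "{D. D \<subseteq> {1..n} \<and> \<Sum>D = i}"
    have "descents xs \<subseteq> {1..n}" if "xs \<in> W" for xs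
      using that distinct_card[of xs] by (auto simp: W_def descents_def)
    then have "{xs \<in> W. \<Sum>(descents xs) = i} = (\<Union>D\<in>?\<D>. {xs \<in> W. descents xs = D})"
      by auto
    also have "card \<dots> = (\<Sum>D\<in>?\<D>. card {xs \<in> W. descents xs = D})"
      using finite_W by (intro card_UN_disjoint) auto
    finally have "card {xs \<in> W. \<Sum>(descents xs) = i} = (\<Sum>D\<in>?\<D>. card {xs \<in> W. descents xs = D})" .
    \<comment> \<open>A set \<open>D\<close> with sum \<open>i \<ge> 1\<close> is nonempty, so each
      summand is even.\<close>
    moreover have "even (\<Sum>D\<in>?\<D>. card {xs \<in> W. descents xs = D})"
      using \<open>i \<ge> 1\<close> finite_W odd
      by (intro dvd_sum even_card_if_odd_card_subset) (auto intro: finite_subset[of _ "{Suc 0..n}"])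
    ultimately show ?thesis
      by (simp only: coeff even_of_nat)
  qed
  ultimately show ?thesis
    by (simp add: n_def)
qed

end
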